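(* Let $K$ be an algebraically closed field, let $d\ge 2$, let $R=K[X_1,\dots,X_d]$, and let $G$ be a finite abelian subgroup of $\mathrm{GL}(K^d)$, generated by $\sigma_1,\dots,\sigma_\ell$, whose order is not divisible by the characteristic of $K$. After a suitable choice of basis of $K^d$, assume that each $\sigma_i$ is the diagonal matrix with diagonal entries $\xi_i^{t_{i1}},\xi_i^{t_{i2}},\dots,\xi_i^{t_{id}}$, where the $t_{ij}$ are non-negative integers and $\xi_i\in K$ is a primitive $n_i$-th root of $1$, and that $\gcd(t_{i1},\dots,t_{id},n_i)=1$ for all $1\le i\le \ell$. Assume that $n_1,\dots,n_\ell$ are pairwise coprime and that $G$ has no pseudo-reflection. Then for every character $\mathcal{X}$ of $G$, the $R^G$-module $R^{\mathcal{X}}$ is nonzero and $$\operatorname{tr}_{R^G}(R^{\mathcal{X}})=R^{\mathcal{X}}R^{\mathcal{X}^{-1}}.$$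
   Context: A matrix $\sigma=(a_{ij})\in \mathrm{GL}(K^d)$ acts on $R$ by the $K$-algebra automorphism $X_j\mapsto\sum_{i=1}^d a_{ij}X_i$; so $\sigma_i(X_j)=\xi_i^{t_{ij}}X_j$. The ring of invariants is $R^G=\{a\in R\mid \sigma(a)=a \text{ for all }\sigma\in G\}$. A character of $G$ is a group homomorphism $\mathcal{X}:G\to \mathrm{GL}(K)=K^\times$; its inverse $\mathcal{X}^{-1}$ maps $\sigma$ to $\mathcal{X}(\sigma^{-1})$. The semi-invariants of weight $\mathcal{X}$ form the $R^G$-module $R^{\mathcal{X}}=\{a\in R\mid \sigma(a)=\mathcal{X}(\sigma)a\text{ for all }\sigma\in G\}$. The product $R^{\mathcal{X}}R^{\mathcal{X}^{-1}}$ is the $R^G$-submodule of $R$ generated by all products $fg$ with $f\in R^{\mathcal{X}}$, $g\in R^{\mathcal{X}^{-1}}$ (it is contained in $R^G$). An element $\sigma\in\mathrm{GL}(K^d)$ is a pseudo-reflection if it has finite order and its eigenspace for the eigenvalue $1$ has dimension $d-1$; $G$ has no pseudo-reflection if no element of $G$ is one. For a commutative Noetherian ring $A$ and a finitely generated $A$-module $M$, the trace of $M$ is the ideal $\operatorname{tr}_A(M)=\sum_{f\in\operatorname{Hom}_A(M,A)}f(M)$. *)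

theory Defs
  imports
    "HOL-Analysis.Cartesian_Space"
    "HOL-Library.Poly_Mapping"
    "HOL-Algebra.Module"
    "HOL-Algebra.Generated_Groups"
    "HOL-Algebra.Algebraic_Closure_Type"
begin

unbundle no fps_syntax

text \<open>
  The polynomial ring in variables indexed by the finite type \<open>'d\<close>: a polynomial is a finitely
  supported map from exponent vectors to coefficients, with convolution as multiplication.
\<close>

type_synonym ('d, 'k) mpol = "('d \<Rightarrow>\<^sub>0 nat) \<Rightarrow>\<^sub>0 'k"

definition Var :: "'d \<Rightarrow> ('d, 'k::comm_ring_1) mpol" where
  "Var j = Poly_Mapping.single (Poly_Mapping.single j 1) 1"

definition Const :: "'k::comm_ring_1 \<Rightarrow> ('d, 'k) mpol" where
  "Const c = Poly_Mapping.single 0 c"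

definition GL :: "('k::field ^ 'd::finite ^ 'd) monoid" where
  "GL = \<lparr>carrier = {A. invertible A}, monoid.mult = (**), one = mat 1\<rparr>"

text \<open>The substitution homomorphism sending the \<open>j\<close>-th variable to \<open>\<Sum>i. a\<^sub>i\<^sub>j X\<^sub>i\<close>,
  where \<open>A $ i $ j\<close> is the entry in row \<open>i\<close> and column \<open>j\<close>.\<close>

definition act :: "'k::field ^ 'd::finite ^ 'd \<Rightarrow> ('d, 'k) mpol \<Rightarrow> ('d, 'k) mpol" where
  "act A p = (\<Sum>m\<in>Poly_Mapping.keys p. Const (Poly_Mapping.lookup p m) *
     (\<Prod>j\<in>UNIV. (\<Sum>i\<in>UNIV. Const (A $ i $ j) * Var i) ^ Poly_Mapping.lookup m j))"

definition invariants :: "('k::field ^ 'd::finite ^ 'd) set \<Rightarrow> ('d, 'k) mpol set" where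
  "invariants G = {a. \<forall>A\<in>G. act A a = a}"

definition semi_invariants ::
  "('k::field ^ 'd::finite ^ 'd) set \<Rightarrow> ('k ^ 'd ^ 'd \<Rightarrow> 'k) \<Rightarrow> ('d, 'k) mpol set" where
  "semi_invariants G \<psi> = {a. \<forall>A\<in>G. act A a = Const (\<psi> A) * a}"

definition invariant_ring :: "('k::field ^ 'd::finite ^ 'd) set \<Rightarrow> ('d, 'k) mpol ring" where
  "invariant_ring G = ring_of_type_algebra \<lparr>carrier := invariants G\<rparr>"

text \<open>The whole polynomial ring, seen as a module by multiplication; its scalars are restricted to
  a subring by the ring argument of \<open>module\<close>, \<open>submodule\<close> etc.\<close>

definition poly_module :: "(('d::finite, 'k::field) mpol, ('d, 'k) mpol) module" where
  "poly_module = \<lparr>carrier = UNIV, monoid.mult = (*), one = 1, ring.zero = 0, add = (+),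
     module.smult = (*)\<rparr>"

definition semi_invariant_module ::
  "('k::field ^ 'd::finite ^ 'd) set \<Rightarrow> ('k ^ 'd ^ 'd \<Rightarrow> 'k) \<Rightarrow>
   (('d, 'k) mpol, ('d, 'k) mpol) module" where
  "semi_invariant_module G \<psi> = poly_module \<lparr>carrier := semi_invariants G \<psi>\<rparr>"

text \<open>Characters are homomorphisms to the multiplicative group of the field; their values outside
  \<open>G\<close> are irrelevant.\<close>

definition characters ::
  "('k::field ^ 'd::finite ^ 'd) set \<Rightarrow> ('k ^ 'd ^ 'd \<Rightarrow> 'k) set" where
  "characters G = hom (GL\<lparr>carrier := G\<rparr>) (units_of ring_of_type_algebra)"

definition inv_character ::
  "('k::field ^ 'd::finite ^ 'd \<Rightarrow> 'k) \<Rightarrow> ('k ^ 'd ^ 'd \<Rightarrow> 'k)" where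
  "inv_character \<psi> = (\<lambda>A. \<psi> (inv\<^bsub>GL\<^esub> A))"

definition pseudo_reflection :: "'k::field ^ 'd::finite ^ 'd \<Rightarrow> bool" where
  "pseudo_reflection A \<longleftrightarrow> A \<in> carrier GL \<and>
     (\<exists>m::nat. m > 0 \<and> A [^]\<^bsub>GL\<^esub> m = \<one>\<^bsub>GL\<^esub>) \<and>
     vec.dim {v. A *v v = v} = CARD('d) - 1"

definition primitive_root_of_unity :: "nat \<Rightarrow> 'k::field \<Rightarrow> bool" where
  "primitive_root_of_unity n z \<longleftrightarrow> n > 0 \<and> z ^ n = 1 \<and> (\<forall>k. 0 < k \<and> k < n \<longrightarrow> z ^ k \<noteq> 1)"

definition module_span ::
  "('a, 'x) ring_scheme \<Rightarrow> ('a, 'b, 'y) module_scheme \<Rightarrow> 'b set \<Rightarrow> 'b set" where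
  "module_span A M S = \<Inter>{N. submodule N A M \<and> S \<subseteq> N}"

definition hom_to_ring ::
  "('a, 'x) ring_scheme \<Rightarrow> ('a, 'b, 'y) module_scheme \<Rightarrow> ('b \<Rightarrow> 'a) set" where
  "hom_to_ring A M = {h \<in> carrier M \<rightarrow> carrier A.
     (\<forall>x\<in>carrier M. \<forall>y\<in>carrier M. h (x \<oplus>\<^bsub>M\<^esub> y) = h x \<oplus>\<^bsub>A\<^esub> h y) \<and>
     (\<forall>a\<in>carrier A. \<forall>x\<in>carrier M. h (a \<odot>\<^bsub>M\<^esub> x) = a \<otimes>\<^bsub>A\<^esub> h x)}"

text \<open>The sum of the images of all homomorphisms to the ring, as the set of finite sums of
  elements of these images.\<close>

definition trace_ideal :: "('a, 'x) ring_scheme \<Rightarrow> ('a, 'b, 'y) module_scheme \<Rightarrow> 'a set" where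
  "trace_ideal A M =
     {(\<Oplus>\<^bsub>A\<^esub>k\<in>{..<r}. h k (x k)) | (r::nat) h x.
        \<forall>k<r. h k \<in> hom_to_ring A M \<and> x k \<in> carrier M}"

definition semi_invariant_product ::
  "('k::field ^ 'd::finite ^ 'd) set \<Rightarrow> ('k ^ 'd ^ 'd \<Rightarrow> 'k) \<Rightarrow> ('k ^ 'd ^ 'd \<Rightarrow> 'k) \<Rightarrow>
   ('d, 'k) mpol set" where
  "semi_invariant_product G \<psi> \<phi> = module_span (invariant_ring G) poly_module
     {f * g | f g. f \<in> semi_invariants G \<psi> \<and> g \<in> semi_invariants G \<phi>}"

end

theory Submission
  imports Defs
begin

text \<open>
  All matrices of \<open>G\<close> are diagonal, so each \<open>A \<in> G\<close> multiplies a monomial \<open>X\<^sup>m\<close> by the scalar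
  \<open>weight A m = \<Prod>j. A\<^sub>j\<^sub>j ^ m\<^sub>j\<close>. Hence a polynomial is a semi-invariant of weight \<open>\<psi>\<close> exactly if
  all its monomials have the character \<open>\<psi>\<close> as weight.

  Multiplication by a semi-invariant of weight \<open>\<psi>\<inverse>\<close> is a homomorphism from the semi-invariants of
  weight \<open>\<psi>\<close> to the invariants, so the trace contains the product. The converse says that there
  are no other homomorphisms (\<open>hom_to_ring_is_mult\<close>). Let \<open>h\<close> be one. Linearity over the invariants
  gives \<open>x h(y) = y h(x)\<close>, because this holds after multiplication by a monomial of weight
  \<open>\<psi>\<inverse>\<close>. So \<open>h\<close> is multiplication by a single fraction \<open>h(X\<^sup>m) / X\<^sup>m\<close>, and the point is that \<open>X\<^sup>m\<close>
  divides \<open>h(X\<^sup>m)\<close>. This can be tested one variable at a time. If \<open>X\<^sup>n\<close> is a monomial of weight \<open>\<psi>\<close>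
  that does not involve the \<open>j\<close>-th variable, then \<open>X\<^sup>n h(X\<^sup>m) = X\<^sup>m h(X\<^sup>n)\<close> shows that each monomial of
  \<open>h(X\<^sup>m)\<close> contains the \<open>j\<close>-th variable at least as often as \<open>X\<^sup>m\<close>.

  That every character is the weight of a monomial avoiding a prescribed variable is where the
  absence of pseudo-reflections enters (\<open>character_is_weight_avoiding_variable\<close>). A diagonal matrix
  other than the identity whose entries are \<open>1\<close> outside position \<open>j\<close> is a pseudo-reflection. So the
  weights of the monomials without the \<open>j\<close>-th variable separate the elements of \<open>G\<close> from the identity,
  and a set of characters of a finite group with this property contains every character as soon as
  it contains the trivial one and is closed under products (\<open>separating_characters_exhaust\<close>).
\<close>

section \<open>Separating characters of a finite group\<close>

lemma (in group) sum_nontrivial_character: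
  fixes \<theta> :: "'a \<Rightarrow> 'k::field"
  assumes mult: "\<And>x y. x \<in> carrier G \<Longrightarrow> y \<in> carrier G \<Longrightarrow> \<theta> (x \<otimes> y) = \<theta> x * \<theta> y"
    and b: "b \<in> carrier G" "\<theta> b \<noteq> 1"
  shows "(\<Sum>x\<in>carrier G. \<theta> x) = 0"
proof -
  have bij: "bij_betw (\<lambda>x. b \<otimes> x) (carrier G) (carrier G)"
    by (rule bij_betw_byWitness[where f' = "\<lambda>x. inv b \<otimes> x"])
      (use b in \<open>auto simp: m_assoc[symmetric]\<close>)
  have "\<theta> b * (\<Sum>x\<in>carrier G. \<theta> x) = (\<Sum>x\<in>carrier G. \<theta> (b \<otimes> x))"
    using b by (simp add: sum_distrib_left mult)
  also have "\<dots> = (\<Sum>x\<in>carrier G. \<theta> x)"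
    by (rule sum.reindex_bij_betw[OF bij])
  finally have "(\<theta> b - 1) * (\<Sum>x\<in>carrier G. \<theta> x) = 0"
    by (simp add: algebra_simps)
  with b show ?thesis by simp
qed

text \<open>
  If \<open>\<psi>\<close> is not in \<open>H\<close>, then \<open>\<psi>\<inverse>\<close> is orthogonal to \<open>H\<close>, hence to the linear span of \<open>H\<close>. The
  span is an algebra of functions. As \<open>H\<close> separates every element from the unit, it contains a
  function that vanishes exactly outside the unit; but \<open>\<psi>\<inverse>\<close> is not orthogonal to that function.
\<close>

lemma (in group) separating_characters_exhaust:
  fixes \<psi> :: "'a \<Rightarrow> 'k::field"
  assumes fin: "finite (carrier G)"
    and H_mult: "\<And>h x y. h \<in> H \<Longrightarrow> x \<in> carrier G \<Longrightarrow> y \<in> carrier G \<Longrightarrow> h (x \<otimes> y) = h x * h y"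
    and H_one: "(\<lambda>_. 1) \<in> H"
    and H_closed: "\<And>h h'. h \<in> H \<Longrightarrow> h' \<in> H \<Longrightarrow> (\<lambda>x. h x * h' x) \<in> H"
    and sep: "\<And>x. x \<in> carrier G \<Longrightarrow> x \<noteq> \<one> \<Longrightarrow> \<exists>h\<in>H. h x \<noteq> h \<one>"
    and \<psi>_mult: "\<And>x y. x \<in> carrier G \<Longrightarrow> y \<in> carrier G \<Longrightarrow> \<psi> (x \<otimes> y) = \<psi> x * \<psi> y"
    and \<psi>_nz: "\<And>x. x \<in> carrier G \<Longrightarrow> \<psi> x \<noteq> 0"
  shows "\<exists>h\<in>H. \<forall>x\<in>carrier G. h x = \<psi> x"
proof (rule ccontr)
  assume none: "\<not> ?thesis"
  \<comment> \<open>\<open>P f\<close> says that \<open>\<psi>\<inverse>\<close> is orthogonal to \<open>H f\<close>. Carrying the factor \<open>h\<close> along makes \<open>P\<close> stable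
    under multiplication of \<open>f\<close> by elements of the span of \<open>H\<close>.\<close>
  define P where "P f \<longleftrightarrow> (\<forall>h\<in>H. (\<Sum>x\<in>carrier G. inverse (\<psi> x) * h x * f x) = 0)" for f
  have P_one: "P (\<lambda>_. 1)"
    unfolding P_def
  proof
    fix h assume h: "h \<in> H"
    with none obtain b where b: "b \<in> carrier G" "h b \<noteq> \<psi> b" by blast
    have "(\<Sum>x\<in>carrier G. inverse (\<psi> x) * h x) = 0"
      by (rule sum_nontrivial_character[of _ b])
        (use b h \<psi>_nz in \<open>auto simp: H_mult \<psi>_mult field_simps\<close>)
    then show "(\<Sum>x\<in>carrier G. inverse (\<psi> x) * h x * 1) = 0" by simp
  qed
  have P_step: "P (\<lambda>x. (h0 x - c) * f x)" if "P f" "h0 \<in> H" for f h0 c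
    unfolding P_def
  proof
    fix h assume h: "h \<in> H"
    have "(\<Sum>x\<in>carrier G. inverse (\<psi> x) * h x * ((h0 x - c) * f x))
      = (\<Sum>x\<in>carrier G. inverse (\<psi> x) * (h x * h0 x) * f x)
        - c * (\<Sum>x\<in>carrier G. inverse (\<psi> x) * h x * f x)"
      by (simp add: sum_distrib_left sum_subtractf[symmetric] algebra_simps)
    also have "\<dots> = 0"
      using bspec[OF that(1)[unfolded P_def] H_closed[OF h that(2)]] bspec[OF that(1)[unfolded P_def] h]
      by simp
    finally show "(\<Sum>x\<in>carrier G. inverse (\<psi> x) * h x * ((h0 x - c) * f x)) = 0" .
  qed
  obtain s where s: "s y \<in> H \<and> s y y \<noteq> s y \<one>" if "y \<in> carrier G - {\<one>}" for y
    using sep by (metis DiffD1 DiffD2 singletonI)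
  \<comment> \<open>The factor for \<open>y\<close> vanishes at \<open>y\<close> and not at the unit.\<close>
  define \<delta> where "\<delta> S x = (\<Prod>y\<in>S. s y x - s y y)" for S x
  have "P (\<delta> S)" if "finite S" "S \<subseteq> carrier G - {\<one>}" for S
    using that
  proof (induction S rule: finite_induct)
    case empty
    then show ?case using P_one by (simp add: \<delta>_def)
  next
    case (insert y S)
    then have "\<delta> (insert y S) = (\<lambda>x. (s y x - s y y) * \<delta> S x)"
      by (auto simp: \<delta>_def fun_eq_iff)
    with insert s P_step show ?case by auto
  qed
  then have P\<delta>: "P (\<delta> (carrier G - {\<one>}))" using fin by simp
  have \<delta>0: "\<delta> (carrier G - {\<one>}) x = 0" if "x \<in> carrier G - {\<one>}" for x
    using that fin unfolding \<delta>_def by (auto intro!: prod_zero)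
  have "s y \<one> \<noteq> s y y" if "y \<in> carrier G - {\<one>}" for y
    using s[OF that] by metis
  then have \<delta>1: "\<delta> (carrier G - {\<one>}) \<one> \<noteq> 0"
    unfolding \<delta>_def using fin by simp
  have "0 = (\<Sum>x\<in>carrier G. inverse (\<psi> x) * 1 * \<delta> (carrier G - {\<one>}) x)"
    using P\<delta> H_one unfolding P_def by auto
  also have "\<dots> = inverse (\<psi> \<one>) * \<delta> (carrier G - {\<one>}) \<one>"
    using fin \<delta>0 by (simp add: sum.remove[of _ \<one>])
  finally show False using \<delta>1 \<psi>_nz[of \<one>] by simp
qed

section \<open>Diagonal matrices\<close>

definition diagonal :: "'k::zero ^ 'd ^ 'd \<Rightarrow> bool" where
  "diagonal A \<longleftrightarrow> (\<forall>i j. i \<noteq> j \<longrightarrow> A $ i $ j = 0)"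

lemma diagonal_mult_nth:
  fixes A B :: "'k::field ^ 'd::finite ^ 'd"
  assumes "diagonal A"
  shows "(A ** B) $ i $ j = A $ i $ i * B $ i $ j"
proof -
  have "(A ** B) $ i $ j = (\<Sum>k\<in>UNIV. if k = i then A $ i $ i * B $ i $ j else 0)"
    unfolding matrix_matrix_mult_def vec_lambda_beta
    using assms by (intro sum.cong) (auto simp: diagonal_def)
  then show ?thesis by simp
qed

lemma group_GL: "group (GL :: ('k::field ^ 'd::finite ^ 'd) monoid)"
proof (rule groupI)
  fix A :: "'k ^ 'd ^ 'd" assume "A \<in> carrier GL"
  then obtain B where "A ** B = mat 1" "B ** A = mat 1"
    by (auto simp: GL_def invertible_def)
  then show "\<exists>B\<in>carrier GL. B \<otimes>\<^bsub>GL\<^esub> A = \<one>\<^bsub>GL\<^esub>"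
    by (auto simp: GL_def invertible_def)
next
  show "\<one>\<^bsub>GL\<^esub> \<in> carrier (GL :: ('k ^ 'd ^ 'd) monoid)"
    by (auto simp: GL_def invertible_def intro: exI[of _ "mat 1"])
qed (auto simp: GL_def invertible_mult matrix_mul_assoc)

lemma diagonal_right_inverse:
  fixes A B :: "'k::field ^ 'd::finite ^ 'd"
  assumes A: "diagonal A" and AB: "A ** B = mat 1"
  shows "diagonal B"
  unfolding diagonal_def
proof (intro allI impI)
  fix i j :: 'd assume ij: "i \<noteq> j"
  have "A $ i $ i * B $ i $ i = 1"
    using diagonal_mult_nth[OF A, of B i i] AB by (simp add: mat_def)
  moreover have "A $ i $ i * B $ i $ j = 0"
    using diagonal_mult_nth[OF A, of B i j] AB ij by (simp add: mat_def)
  ultimately show "B $ i $ j = 0" by auto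
qed

lemma generate_diagonal:
  fixes S :: "('k::field ^ 'd::finite ^ 'd) set"
  assumes "generate GL S \<subseteq> carrier GL" and "\<And>A. A \<in> S \<Longrightarrow> diagonal A"
    and "A \<in> generate GL S"
  shows "diagonal A"
  using assms(3)
proof induction
  case one
  then show ?case by (simp add: GL_def diagonal_def mat_def)
next
  case (incl h)
  then show ?case by (rule assms)
next
  case (inv h)
  have "h \<in> carrier GL" using generate.incl[OF inv] assms(1) by blast
  then have "h ** inv\<^bsub>GL\<^esub> h = mat 1"
    using group.r_inv[OF group_GL] by (auto simp: GL_def)
  with assms(2)[OF inv] show ?case by (rule diagonal_right_inverse)
next
  case (eng h1 h2)
  then show ?case
    by (auto simp: GL_def diagonal_def diagonal_mult_nth)
qed

lemma dim_coordinate_hyperplane: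
  "vec.dim {v :: 'k::field ^ 'd::finite. v $ j = 0} = CARD('d) - 1"
proof -
  define B :: "('k ^ 'd) set" where "B = (\<lambda>i. axis i 1) ` (UNIV - {j})"
  have "B \<subseteq> {v. v $ j = 0}" by (auto simp: B_def axis_def)
  moreover have "{v. v $ j = 0} \<subseteq> vec.span B"
  proof
    fix v :: "'k ^ 'd" assume v: "v \<in> {v. v $ j = 0}"
    have "v = (\<Sum>i\<in>UNIV. v $ i *s axis i 1)"
      by (simp add: basis_expansion)
    also have "\<dots> = (\<Sum>i\<in>UNIV - {j}. v $ i *s axis i 1)"
      using v by (subst sum.remove[of _ j]) auto
    also have "\<dots> \<in> vec.span B"
      by (intro vec.span_sum vec.span_scale vec.span_base) (auto simp: B_def)
    finally show "v \<in> vec.span B" .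
  qed
  moreover have "vec.independent B"
    by (rule vec.independent_mono[OF independent_cart_basis]) (auto simp: B_def cart_basis_def)
  moreover have "card B = CARD('d) - 1"
    unfolding B_def by (subst card_image) (auto simp: inj_on_def axis_eq_axis card_Diff_singleton)
  ultimately show ?thesis by (rule vec.dim_unique)
qed

text \<open>
  The entry at \<open>j\<close> differs from \<open>1\<close>, so the fixed space is the \<open>j\<close>-th coordinate hyperplane; the
  order is finite because it divides that of \<open>G\<close>.
\<close>

lemma diagonal_pseudo_reflectionI:
  fixes A :: "'k::field ^ 'd::finite ^ 'd"
  assumes G: "subgroup G GL" "finite G" "A \<in> G" and A: "diagonal A" "A \<noteq> mat 1"
    and one: "\<And>i. i \<noteq> j \<Longrightarrow> A $ i $ i = 1"
  shows "pseudo_reflection A"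
proof -
  interpret GL: group "GL :: ('k ^ 'd ^ 'd) monoid" by (rule group_GL)
  have A_GL: "A \<in> carrier GL" using G subgroup.subset by blast
  have "A [^]\<^bsub>GL\<^esub> card G = \<one>\<^bsub>GL\<^esub>"
  proof -
    interpret S: group "GL\<lparr>carrier := G\<rparr>" by (rule GL.subgroup_imp_group[OF G(1)])
    have "A [^]\<^bsub>GL\<lparr>carrier := G\<rparr>\<^esub> card G = \<one>\<^bsub>GL\<^esub>"
      using S.pow_order_eq_1[of A] G unfolding Coset.order_def by simp
    then show ?thesis by (simp add: nat_pow_def)
  qed
  moreover have "card G > 0" using G by (auto simp: card_gt_0_iff)
  ultimately have "\<exists>m::nat. m > 0 \<and> A [^]\<^bsub>GL\<^esub> m = \<one>\<^bsub>GL\<^esub>" by blast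
  moreover have "{v. A *v v = v} = {v. v $ j = 0}"
  proof -
    have mv: "(A *v v) $ i = A $ i $ i * v $ i" for v i
    proof -
      have "(A *v v) $ i = (\<Sum>k\<in>UNIV. if k = i then A $ i $ i * v $ i else 0)"
        unfolding matrix_vector_mult_def vec_lambda_beta
        using A(1) by (intro sum.cong) (auto simp: diagonal_def)
      then show ?thesis by simp
    qed
    have "A $ j $ j \<noteq> 1"
    proof
      assume "A $ j $ j = 1"
      then have "A $ i $ i = 1" for i using one by (cases "i = j") auto
      then have "A = mat 1" using A(1) by (auto simp: vec_eq_iff mat_def diagonal_def)
      with A show False by simp
    qed
    then have "A $ i $ i * v $ i = v $ i \<longleftrightarrow> i \<noteq> j \<or> v $ i = 0" for v :: "'k ^ 'd" and i
      using one by (cases "i = j") auto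
    then show ?thesis by (auto simp: vec_eq_iff mv)
  qed
  ultimately show ?thesis
    using A_GL dim_coordinate_hyperplane[where ?'k = 'k, of j] by (simp add: pseudo_reflection_def)
qed

section \<open>Weights of monomials\<close>

definition weight :: "'k::field ^ 'd::finite ^ 'd \<Rightarrow> ('d \<Rightarrow>\<^sub>0 nat) \<Rightarrow> 'k" where
  "weight A m = (\<Prod>j\<in>UNIV. A $ j $ j ^ Poly_Mapping.lookup m j)"

lemma weight_zero [simp]: "weight A 0 = 1"
  by (simp add: weight_def)

lemma weight_plus: "weight A (m + m') = weight A m * weight A m'"
  by (simp add: weight_def lookup_add power_add prod.distrib)

lemma weight_mult:
  assumes "diagonal A"
  shows "weight (A ** B) m = weight A m * weight B m"
  using assms by (simp add: weight_def diagonal_mult_nth power_mult_distrib prod.distrib)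

lemma weight_single: "weight A (Poly_Mapping.single i 1) = A $ i $ i"
proof -
  have "weight A (Poly_Mapping.single i 1) = (\<Prod>j\<in>UNIV. if j = i then A $ j $ j else 1)"
    unfolding weight_def by (intro prod.cong) (auto simp: lookup_single)
  then show ?thesis by simp
qed

lemma sum_single_lookup: "(\<Sum>k\<in>Poly_Mapping.keys p. Poly_Mapping.single k (Poly_Mapping.lookup p k)) = p"
  by (rule poly_mapping_eqI) (auto simp: lookup_sum lookup_single when_def in_keys_iff)

lemma sum_single_lookup_UNIV:
  "(\<Sum>j\<in>(UNIV :: 'd::finite set). Poly_Mapping.single j (Poly_Mapping.lookup m j)) = m"
  by (rule poly_mapping_eqI) (auto simp: lookup_sum lookup_single when_def)

lemma single_power:
  "Poly_Mapping.single (m :: 'd \<Rightarrow>\<^sub>0 nat) (a::'k::comm_ring_1) ^ n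
     = Poly_Mapping.single (\<Sum>_<n. m) (a ^ n)"
  by (induction n) (auto simp: mult_single add.commute)

lemma prod_single:
  "(\<Prod>j\<in>S. Poly_Mapping.single (m j :: 'd \<Rightarrow>\<^sub>0 nat) (a j::'k::comm_ring_1))
     = Poly_Mapping.single (\<Sum>j\<in>S. m j) (\<Prod>j\<in>S. a j)"
  by (induction S rule: infinite_finite_induct) (auto simp: mult_single)

text \<open>
  The substitution sends the \<open>j\<close>-th variable to a scalar multiple of itself, so it acts on each
  monomial separately.
\<close>

lemma act_diagonal:
  fixes A :: "'k::field ^ 'd::finite ^ 'd"
  assumes "diagonal A"
  shows "Poly_Mapping.lookup (act A p) m = weight A m * Poly_Mapping.lookup p m"
proof -
  have lin: "(\<Sum>i\<in>UNIV. Const (A $ i $ j) * Var i)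
      = Poly_Mapping.single (Poly_Mapping.single j 1) (A $ j $ j)" for j
  proof -
    have "(\<Sum>i\<in>UNIV. Const (A $ i $ j) * Var i)
      = (\<Sum>i\<in>UNIV. if i = j then Poly_Mapping.single (Poly_Mapping.single j 1) (A $ j $ j) else 0)"
      using assms by (intro sum.cong) (auto simp: Const_def Var_def mult_single diagonal_def)
    then show ?thesis by simp
  qed
  have mult_exp: "(\<Sum>_<e. Poly_Mapping.single j (1::nat)) = Poly_Mapping.single j e" for e and j :: 'd
    by (induction e) (auto simp: single_add[symmetric])
  have "act A p = (\<Sum>m\<in>Poly_Mapping.keys p. Poly_Mapping.single m (Poly_Mapping.lookup p m * weight A m))"
    unfolding act_def lin single_power prod_single mult_exp sum_single_lookup_UNIV
    by (simp add: Const_def mult_single weight_def)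
  then show ?thesis
    by (auto simp: lookup_sum lookup_single when_def in_keys_iff)
qed

lemma lookup_Const_mult: "Poly_Mapping.lookup (Const c * p) m = c * Poly_Mapping.lookup p m"
proof -
  have "Const c * p = (\<Sum>k\<in>Poly_Mapping.keys p. Poly_Mapping.single k (c * Poly_Mapping.lookup p k))"
    by (subst sum_single_lookup[of p, symmetric]) (simp add: sum_distrib_left Const_def mult_single)
  then show ?thesis
    by (auto simp: lookup_sum lookup_single when_def in_keys_iff)
qed

lemma lookup_monomial_mult:
  fixes p :: "('d, 'k::comm_ring_1) mpol"
  shows "Poly_Mapping.lookup (Poly_Mapping.single m 1 * p) (m + k) = Poly_Mapping.lookup p k"
proof -
  have "Poly_Mapping.single m 1 * p
      = (\<Sum>k\<in>Poly_Mapping.keys p. Poly_Mapping.single (m + k) (Poly_Mapping.lookup p k))"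
    by (subst sum_single_lookup[of p, symmetric]) (simp add: sum_distrib_left mult_single)
  then show ?thesis
    by (auto simp: lookup_sum lookup_single when_def in_keys_iff)
qed

text \<open>
  Multiplication by a monomial only shifts the exponents. All cancellations below are of monomials.
\<close>

lemma monomial_mult_cancel:
  fixes p q :: "('d, 'k::comm_ring_1) mpol"
  assumes "Poly_Mapping.single m 1 * p = Poly_Mapping.single m 1 * q"
  shows "p = q"
  using assms lookup_monomial_mult[of m p] lookup_monomial_mult[of m q]
  by (intro poly_mapping_eqI) simp

lemma monomial_dvdI:
  fixes u :: "('d, 'k::comm_ring_1) mpol"
  assumes "\<And>k j. k \<in> Poly_Mapping.keys u \<Longrightarrow> Poly_Mapping.lookup m j \<le> Poly_Mapping.lookup k j"
  obtains g where "u = Poly_Mapping.single m 1 * g"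
proof -
  have "Poly_Mapping.single m 1 * (\<Sum>k\<in>Poly_Mapping.keys u. Poly_Mapping.single (k - m) (Poly_Mapping.lookup u k))
      = (\<Sum>k\<in>Poly_Mapping.keys u. Poly_Mapping.single k (Poly_Mapping.lookup u k))"
    unfolding sum_distrib_left
  proof (rule sum.cong)
    fix k assume "k \<in> Poly_Mapping.keys u"
    then have "m + (k - m) = k"
      using assms by (intro poly_mapping_eqI) (simp add: lookup_add lookup_minus)
    then show "Poly_Mapping.single m 1 * Poly_Mapping.single (k - m) (Poly_Mapping.lookup u k)
        = Poly_Mapping.single k (Poly_Mapping.lookup u k)"
      by (simp add: mult_single)
  qed simp
  then show thesis unfolding sum_single_lookup by (metis that)
qed

section \<open>Semi-invariants of a diagonal group\<close>

lemma semi_invariants_diagonal: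
  assumes "\<And>A. A \<in> G \<Longrightarrow> diagonal A"
  shows "a \<in> semi_invariants G \<psi> \<longleftrightarrow> (\<forall>m\<in>Poly_Mapping.keys a. \<forall>A\<in>G. weight A m = \<psi> A)"
proof -
  have "act A a = Const (\<psi> A) * a \<longleftrightarrow> (\<forall>m\<in>Poly_Mapping.keys a. weight A m = \<psi> A)" if "A \<in> G" for A
    using assms[OF that]
    by (auto simp: poly_mapping_eq_iff fun_eq_iff act_diagonal lookup_Const_mult in_keys_iff)
  then show ?thesis by (auto simp: semi_invariants_def)
qed

lemma semi_invariants_mult:
  assumes "\<And>A. A \<in> G \<Longrightarrow> diagonal A"
    and "f \<in> semi_invariants G \<psi>" "g \<in> semi_invariants G \<phi>"
    and "\<And>A. A \<in> G \<Longrightarrow> \<psi> A * \<phi> A = \<theta> A"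
  shows "f * g \<in> semi_invariants G \<theta>"
proof -
  have "weight A m = \<theta> A" if "m \<in> Poly_Mapping.keys (f * g)" "A \<in> G" for m A
    using that assms keys_mult[of f g]
    by (force simp: semi_invariants_diagonal weight_plus)
  then show ?thesis using assms(1) by (simp add: semi_invariants_diagonal)
qed

lemma semi_invariants_add:
  assumes "\<And>A. A \<in> G \<Longrightarrow> diagonal A"
    and "f \<in> semi_invariants G \<psi>" "g \<in> semi_invariants G \<psi>"
  shows "f + g \<in> semi_invariants G \<psi>"
  using assms keys_add[of f g] by (fastforce simp: semi_invariants_diagonal)

lemma invariants_eq_semi_invariants: "invariants G = semi_invariants G (\<lambda>_. 1)"
  by (simp add: invariants_def semi_invariants_def Const_def)

lemma Const_invariant:
  assumes "\<And>A. A \<in> G \<Longrightarrow> diagonal A"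
  shows "Const c \<in> invariants G"
  using assms by (auto simp: invariants_eq_semi_invariants semi_invariants_diagonal Const_def)

lemma monomial_semi_invariant:
  assumes "\<And>A. A \<in> G \<Longrightarrow> diagonal A" and "\<And>A. A \<in> G \<Longrightarrow> weight A m = \<psi> A"
  shows "Poly_Mapping.single m 1 \<in> semi_invariants G \<psi>"
  using assms by (simp add: semi_invariants_diagonal)

lemma module_poly_module:
  fixes G :: "('k::field ^ 'd::finite ^ 'd) set"
  assumes diag: "\<And>A. A \<in> G \<Longrightarrow> diagonal A"
  shows "module (invariant_ring G) poly_module"
proof -
  note inv = invariants_eq_semi_invariants[of G]
  have add: "a + b \<in> invariants G" and mult: "a * b \<in> invariants G"
    if "a \<in> invariants G" "b \<in> invariants G" for a b
    using that semi_invariants_add[OF diag] semi_invariants_mult[OF diag, of G] by (auto simp: inv)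
  have neg: "- a \<in> invariants G" if "a \<in> invariants G" for a
  proof -
    have "Const (- 1) * a \<in> invariants G" by (rule mult[OF Const_invariant[OF diag] that])
    then show ?thesis by (simp add: Const_def single_uminus)
  qed
  have zero: "0 \<in> invariants G" and one: "1 \<in> invariants G"
    using Const_invariant[OF diag, of G 0] Const_invariant[OF diag, of G 1] by (simp_all add: Const_def)
  have "cring (invariant_ring G)"
  proof (intro cringI abelian_groupI comm_monoidI)
    fix x assume "x \<in> carrier (invariant_ring G)"
    then show "\<exists>y\<in>carrier (invariant_ring G). y \<oplus>\<^bsub>invariant_ring G\<^esub> x = \<zero>\<^bsub>invariant_ring G\<^esub>"
      using neg[of x] by (auto simp: invariant_ring_def ring_of_type_algebra_def intro!: bexI[of _ "- x"])
  qed (auto simp: invariant_ring_def ring_of_type_algebra_def add mult zero one algebra_simps)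
  moreover have "abelian_group (poly_module :: (('d, 'k) mpol, ('d, 'k) mpol) module)"
  proof (rule abelian_groupI)
    fix x :: "('d, 'k) mpol"
    show "\<exists>y\<in>carrier poly_module. y \<oplus>\<^bsub>poly_module\<^esub> x = \<zero>\<^bsub>poly_module\<^esub>"
      by (auto simp: poly_module_def intro!: exI[of _ "- x"])
  qed (auto simp: poly_module_def algebra_simps)
  ultimately show ?thesis
    by (rule moduleI) (auto simp: invariant_ring_def ring_of_type_algebra_def poly_module_def algebra_simps)
qed

lemma finsum_invariant_ring:
  fixes G :: "('k::field ^ 'd::finite ^ 'd) set"
  assumes diag: "\<And>A. A \<in> G \<Longrightarrow> diagonal A"
    and "finite S" and "\<And>k. k \<in> S \<Longrightarrow> f k \<in> invariants G"
  shows "(\<Oplus>\<^bsub>invariant_ring G\<^esub>k\<in>S. f k) = (\<Sum>k\<in>S. f k)"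
proof -
  interpret module "invariant_ring G" poly_module by (rule module_poly_module[OF diag])
  show ?thesis
    using assms(2,3)
  proof (induction S rule: finite_induct)
    case empty
    then show ?case by (simp, simp add: invariant_ring_def ring_of_type_algebra_def)
  next
    case (insert k S)
    then have "f \<in> S \<rightarrow> carrier (invariant_ring G)" "f k \<in> carrier (invariant_ring G)"
      by (auto simp: invariant_ring_def)
    with insert show ?case
      by (simp, simp add: invariant_ring_def ring_of_type_algebra_def)
  qed
qed

section \<open>Homomorphisms into the invariant ring\<close>

lemma hom_to_ring_iff:
  "h \<in> hom_to_ring (invariant_ring G) (semi_invariant_module G \<psi>) \<longleftrightarrow>
     (\<forall>x\<in>semi_invariants G \<psi>. h x \<in> invariants G) \<and>
     (\<forall>x\<in>semi_invariants G \<psi>. \<forall>y\<in>semi_invariants G \<psi>. h (x + y) = h x + h y) \<and>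
     (\<forall>a\<in>invariants G. \<forall>x\<in>semi_invariants G \<psi>. h (a * x) = a * h x)"
  by (auto simp: hom_to_ring_def invariant_ring_def semi_invariant_module_def poly_module_def
      ring_of_type_algebra_def)

lemma mult_in_hom_to_ring:
  assumes diag: "\<And>A. A \<in> G \<Longrightarrow> diagonal A"
    and inv: "\<And>A. A \<in> G \<Longrightarrow> \<psi> A * \<phi> A = 1"
    and g: "g \<in> semi_invariants G \<phi>"
  shows "(\<lambda>x. x * g) \<in> hom_to_ring (invariant_ring G) (semi_invariant_module G \<psi>)"
  unfolding hom_to_ring_iff invariants_eq_semi_invariants
  using semi_invariants_mult[OF diag _ g inv] by (auto simp: algebra_simps)

text \<open>
  The hypothesis \<open>avoid\<close> stands for the fact that the semi-invariants of weight \<open>\<psi>\<close> have no common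
  factor: each variable is missing from one of their monomials, so no variable can occur in the
  denominator of \<open>h(X\<^sup>m) / X\<^sup>m\<close>.
\<close>

lemma hom_to_ring_is_mult:
  fixes G :: "('k::field ^ 'd::finite ^ 'd) set"
  assumes diag: "\<And>A. A \<in> G \<Longrightarrow> diagonal A"
    and inv: "\<And>A. A \<in> G \<Longrightarrow> \<psi> A * \<phi> A = 1"
    and avoid: "\<And>j. \<exists>m. Poly_Mapping.lookup m j = 0 \<and> (\<forall>A\<in>G. weight A m = \<psi> A)"
    and \<phi>: "\<forall>A\<in>G. weight A m0 = \<phi> A"
    and h: "h \<in> hom_to_ring (invariant_ring G) (semi_invariant_module G \<psi>)"
  obtains g where "g \<in> semi_invariants G \<phi>" "\<And>x. x \<in> semi_invariants G \<psi> \<Longrightarrow> h x = x * g"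
proof -
  define mon :: "('d \<Rightarrow>\<^sub>0 nat) \<Rightarrow> ('d, 'k) mpol" where "mon = (\<lambda>m. Poly_Mapping.single m 1)"
  have mon_m0: "mon m0 \<in> semi_invariants G \<phi>"
    using monomial_semi_invariant[OF diag] \<phi> by (simp add: mon_def)
  have scale: "h (a * x) = a * h x" if "a \<in> invariants G" "x \<in> semi_invariants G \<psi>" for a x
    using h that by (auto simp: hom_to_ring_iff)
  have prod_inv: "x * mon m0 \<in> invariants G" if "x \<in> semi_invariants G \<psi>" for x
    unfolding invariants_eq_semi_invariants
    by (rule semi_invariants_mult[OF diag that mon_m0]) (simp_all add: inv)
  \<comment> \<open>Multiplying by \<open>mon m0\<close> turns semi-invariants of weight \<open>\<psi>\<close> into scalars of the module, which
    can be moved through \<open>h\<close>.\<close>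
  have swap: "x * h y = y * h x" if "x \<in> semi_invariants G \<psi>" "y \<in> semi_invariants G \<psi>" for x y
  proof -
    have "(x * mon m0) * h y = h ((x * mon m0) * y)" using that by (simp add: scale prod_inv)
    also have "\<dots> = h ((y * mon m0) * x)" by (simp add: mult_ac)
    also have "\<dots> = (y * mon m0) * h x" using that by (simp add: scale prod_inv)
    finally have "mon m0 * (x * h y) = mon m0 * (y * h x)" by (simp add: mult_ac)
    then show ?thesis unfolding mon_def by (rule monomial_mult_cancel)
  qed
  obtain m where m: "\<forall>A\<in>G. weight A m = \<psi> A" using avoid by blast
  have mon_m: "mon m \<in> semi_invariants G \<psi>"
    using monomial_semi_invariant[OF diag] m by (simp add: mon_def)
  have "Poly_Mapping.lookup m j \<le> Poly_Mapping.lookup k j" if k: "k \<in> Poly_Mapping.keys (h (mon m))" for k j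
  proof -
    obtain m' where m': "Poly_Mapping.lookup m' j = 0" "\<forall>A\<in>G. weight A m' = \<psi> A" using avoid by blast
    have "mon m' * h (mon m) = mon m * h (mon m')"
      by (rule swap) (use monomial_semi_invariant[OF diag] m' mon_m in \<open>simp_all add: mon_def\<close>)
    moreover have "m' + k \<in> Poly_Mapping.keys (mon m' * h (mon m))"
      using k by (simp add: mon_def in_keys_iff lookup_monomial_mult)
    ultimately obtain k' where "m' + k = m + k'"
      using keys_mult[of "mon m" "h (mon m')"] by (auto simp: mon_def)
    then have "Poly_Mapping.lookup m' j + Poly_Mapping.lookup k j = Poly_Mapping.lookup m j + Poly_Mapping.lookup k' j"
      by (metis lookup_add)
    with m' show ?thesis by simp
  qed
  then obtain g where g: "h (mon m) = mon m * g"
    unfolding mon_def by (rule monomial_dvdI)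
  show thesis
  proof
    have "weight A k = \<phi> A" if "k \<in> Poly_Mapping.keys g" "A \<in> G" for k A
    proof -
      have "m + k \<in> Poly_Mapping.keys (h (mon m))"
        using that unfolding g in_keys_iff by (simp add: mon_def lookup_monomial_mult)
      moreover have "h (mon m) \<in> semi_invariants G (\<lambda>_. 1)"
        using h mon_m by (simp add: hom_to_ring_iff invariants_eq_semi_invariants)
      ultimately have "weight A (m + k) = 1"
        using that(2) by (simp add: semi_invariants_diagonal[OF diag])
      then have "\<psi> A * weight A k = \<psi> A * \<phi> A"
        using m that by (simp add: weight_plus inv)
      moreover have "\<psi> A \<noteq> 0" using inv[OF that(2)] by auto
      ultimately show ?thesis by simp
    qed
    then show "g \<in> semi_invariants G \<phi>" by (simp add: semi_invariants_diagonal[OF diag])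
    fix x assume x: "x \<in> semi_invariants G \<psi>"
    have "mon m * h x = mon m * (x * g)" using swap[OF mon_m x] by (simp add: g mult_ac)
    then show "h x = x * g" unfolding mon_def by (rule monomial_mult_cancel)
  qed
qed

text \<open>
  If all homomorphisms are multiplications by semi-invariants of weight \<open>\<phi>\<close>, then the trace consists
  of the finite sums of products \<open>f g\<close>. These already form a submodule, because an invariant scalar
  can be absorbed into the factor \<open>f\<close>, so they are the submodule generated by the products.
\<close>

lemma trace_ideal_semi_invariants:
  fixes G :: "('k::field ^ 'd::finite ^ 'd) set"
  assumes diag: "\<And>A. A \<in> G \<Longrightarrow> diagonal A"
    and inv: "\<And>A. A \<in> G \<Longrightarrow> \<psi> A * \<phi> A = 1"
    and homs: "\<And>h. h \<in> hom_to_ring (invariant_ring G) (semi_invariant_module G \<psi>) \<Longrightarrow>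
      \<exists>g\<in>semi_invariants G \<phi>. \<forall>x\<in>semi_invariants G \<psi>. h x = x * g"
  shows "trace_ideal (invariant_ring G) (semi_invariant_module G \<psi>) = semi_invariant_product G \<psi> \<phi>"
proof -
  let ?T = "trace_ideal (invariant_ring G) (semi_invariant_module G \<psi>)"
  let ?S = "{f * g | f g. f \<in> semi_invariants G \<psi> \<and> g \<in> semi_invariants G \<phi>}"
  interpret module "invariant_ring G" poly_module by (rule module_poly_module[OF diag])
  have T: "y \<in> ?T \<longleftrightarrow> (\<exists>(r::nat) f g. y = (\<Sum>k<r. f k * g k) \<and>
      (\<forall>k<r. f k \<in> semi_invariants G \<psi> \<and> g k \<in> semi_invariants G \<phi>))" for y
  proof
    assume "y \<in> ?T"
    then obtain r :: nat and h x where y: "y = (\<Oplus>\<^bsub>invariant_ring G\<^esub>k\<in>{..<r}. h k (x k))"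
      and hx: "\<And>k. k < r \<Longrightarrow> h k \<in> hom_to_ring (invariant_ring G) (semi_invariant_module G \<psi>)"
        "\<And>k. k < r \<Longrightarrow> x k \<in> semi_invariants G \<psi>"
      by (auto simp: trace_ideal_def semi_invariant_module_def)
    have "\<forall>k\<in>{..<r}. \<exists>g. g \<in> semi_invariants G \<phi> \<and> h k (x k) = x k * g"
      using homs hx by blast
    then obtain g where g: "g k \<in> semi_invariants G \<phi>" "h k (x k) = x k * g k" if "k < r" for k
      unfolding bchoice_iff by blast
    have "y = (\<Sum>k<r. h k (x k))"
      unfolding y by (rule finsum_invariant_ring[OF diag]) (use hx in \<open>auto simp: hom_to_ring_iff\<close>)
    also have "\<dots> = (\<Sum>k<r. x k * g k)" using g by simp
    finally show "\<exists>(r::nat) f g. y = (\<Sum>k<r. f k * g k) \<and>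
        (\<forall>k<r. f k \<in> semi_invariants G \<psi> \<and> g k \<in> semi_invariants G \<phi>)"
      using g hx by blast
  next
    assume "\<exists>(r::nat) f g. y = (\<Sum>k<r. f k * g k) \<and>
        (\<forall>k<r. f k \<in> semi_invariants G \<psi> \<and> g k \<in> semi_invariants G \<phi>)"
    then obtain r :: nat and f g where y: "y = (\<Sum>k<r. f k * g k)"
      and fg: "\<And>k. k < r \<Longrightarrow> f k \<in> semi_invariants G \<psi>" "\<And>k. k < r \<Longrightarrow> g k \<in> semi_invariants G \<phi>"
      by blast
    define h where "h k = (\<lambda>x. x * g k)" for k
    have h: "h k \<in> hom_to_ring (invariant_ring G) (semi_invariant_module G \<psi>)" if "k < r" for k
      unfolding h_def by (rule mult_in_hom_to_ring[OF diag inv fg(2)[OF that]])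
    have "(\<Oplus>\<^bsub>invariant_ring G\<^esub>k\<in>{..<r}. h k (f k)) = (\<Sum>k<r. h k (f k))"
      by (rule finsum_invariant_ring[OF diag]) (use h fg in \<open>auto simp: hom_to_ring_iff\<close>)
    then have "y = (\<Oplus>\<^bsub>invariant_ring G\<^esub>k\<in>{..<r}. h k (f k))"
      by (simp add: y h_def)
    moreover have "\<forall>k<r. h k \<in> hom_to_ring (invariant_ring G) (semi_invariant_module G \<psi>) \<and>
        f k \<in> carrier (semi_invariant_module G \<psi>)"
      using h fg by (simp add: semi_invariant_module_def)
    ultimately show "y \<in> ?T" unfolding trace_ideal_def by blast
  qed
  have T_I: "(\<Sum>k<r. f k * g k) \<in> ?T"
    if "\<And>k. k < r \<Longrightarrow> f k \<in> semi_invariants G \<psi> \<and> g k \<in> semi_invariants G \<phi>" for r :: nat and f g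
    unfolding T using that by (intro exI conjI refl allI impI) auto
  have smult_T: "a * y \<in> ?T" if a: "a \<in> invariants G" and y: "y \<in> ?T" for a y
  proof -
    obtain r :: nat and f g where "y = (\<Sum>k<r. f k * g k)"
      and fg: "\<And>k. k < r \<Longrightarrow> f k \<in> semi_invariants G \<psi> \<and> g k \<in> semi_invariants G \<phi>"
      using y unfolding T by blast
    then have "a * y = (\<Sum>k<r. (a * f k) * g k)" by (simp add: sum_distrib_left mult_ac)
    moreover have "a * f k \<in> semi_invariants G \<psi>" if "k < r" for k
      using a fg[OF that] semi_invariants_mult[OF diag, of G a "\<lambda>_. 1" "f k" \<psi> \<psi>]
      by (simp add: invariants_eq_semi_invariants)
    ultimately show ?thesis using fg by (simp add: T_I)
  qed
  have add_T: "y + z \<in> ?T" if y: "y \<in> ?T" and z: "z \<in> ?T" for y z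
  proof -
    obtain r :: nat and f g where y: "y = (\<Sum>k<r. f k * g k)"
      and fg: "\<And>k. k < r \<Longrightarrow> f k \<in> semi_invariants G \<psi> \<and> g k \<in> semi_invariants G \<phi>"
      using y unfolding T by blast
    obtain r' :: nat and f' g' where z: "z = (\<Sum>k<r'. f' k * g' k)"
      and fg': "\<And>k. k < r' \<Longrightarrow> f' k \<in> semi_invariants G \<psi> \<and> g' k \<in> semi_invariants G \<phi>"
      using z unfolding T by blast
    define F where "F k = (if k < r then f k else f' (k - r))" for k
    define E where "E k = (if k < r then g k else g' (k - r))" for k
    have "(\<Sum>k<r + r'. F k * E k) = y + z"
      unfolding y z by (induction r') (simp_all add: F_def E_def)
    moreover have "(\<Sum>k<r + r'. F k * E k) \<in> ?T"
      by (rule T_I) (use fg fg' in \<open>auto simp: F_def E_def\<close>)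
    ultimately show ?thesis by simp
  qed
  have sub_T: "submodule ?T (invariant_ring G) poly_module"
  proof (rule submoduleI)
    show "\<zero>\<^bsub>poly_module\<^esub> \<in> ?T"
      unfolding T by (rule exI[of _ 0]) (simp add: poly_module_def)
    fix y assume y: "y \<in> ?T"
    have "\<ominus>\<^bsub>poly_module\<^esub> y = Const (- 1) * y"
      by (rule M.minus_equality) (simp_all add: poly_module_def Const_def single_uminus)
    then show "\<ominus>\<^bsub>poly_module\<^esub> y \<in> ?T"
      using smult_T[OF Const_invariant[OF diag] y] by simp
  qed (use add_T smult_T in \<open>auto simp: poly_module_def invariant_ring_def\<close>)
  have S_T: "?S \<subseteq> ?T"
  proof
    fix y assume "y \<in> ?S"
    then obtain f g where "y = f * g" "f \<in> semi_invariants G \<psi>" "g \<in> semi_invariants G \<phi>" by blast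
    then show "y \<in> ?T"
      using T_I[of 1 "\<lambda>_. f" "\<lambda>_. g"] by simp
  qed
  have T_least: "?T \<subseteq> N" if N: "submodule N (invariant_ring G) poly_module" "?S \<subseteq> N" for N
  proof
    fix y assume "y \<in> ?T"
    then obtain r :: nat and f g where y: "y = (\<Sum>k<r. f k * g k)"
      and fg: "\<And>k. k < r \<Longrightarrow> f k \<in> semi_invariants G \<psi> \<and> g k \<in> semi_invariants G \<phi>"
      unfolding T by blast
    have zero: "0 \<in> N"
      using subgroup.one_closed[OF submodule.axioms(1)[OF N(1)]] by (simp add: poly_module_def)
    have plus: "a + b \<in> N" if "a \<in> N" "b \<in> N" for a b
      using submoduleE(5)[OF N(1) that] by (simp add: poly_module_def)
    have "(\<Sum>k<r'. f k * g k) \<in> N" if "r' \<le> r" for r'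
      using that
    proof (induction r')
      case 0
      then show ?case using zero by simp
    next
      case (Suc r')
      then have "f r' * g r' \<in> N" using fg[of r'] N(2) by auto
      with Suc show ?case by (simp add: plus)
    qed
    then show "y \<in> N" unfolding y by simp
  qed
  show ?thesis
    unfolding semi_invariant_product_def module_span_def
  proof (rule equalityI)
    show "?T \<subseteq> \<Inter> {N. submodule N (invariant_ring G) poly_module \<and> ?S \<subseteq> N}"
      by (rule Inter_greatest) (use T_least in simp)
    show "\<Inter> {N. submodule N (invariant_ring G) poly_module \<and> ?S \<subseteq> N} \<subseteq> ?T"
      by (rule Inter_lower) (use sub_T S_T in simp)
  qed
qed

section \<open>Diagonal groups without pseudo-reflections\<close>

lemma characters_iff:
  "\<psi> \<in> characters G \<longleftrightarrow>
     (\<forall>A\<in>G. \<psi> A \<noteq> 0) \<and> (\<forall>A\<in>G. \<forall>B\<in>G. \<psi> (A ** B) = \<psi> A * \<psi> B)"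
proof -
  have unit: "(\<exists>y. y * x = 1 \<and> x * y = 1) \<longleftrightarrow> x \<noteq> 0" for x :: 'a
    by (auto intro: exI[of _ "inverse x"])
  show ?thesis
    by (auto simp: characters_def hom_def units_of_def ring_of_type_algebra_def Units_def GL_def unit)
qed

text \<open>
  An element of \<open>G\<close> on which all weights of monomials without the \<open>j\<close>-th variable are trivial has
  entries \<open>1\<close> outside position \<open>j\<close>, so it is the identity, as \<open>G\<close> has no pseudo-reflection. Exponents
  are non-negative, but this is no loss: the lemma on separating characters asks only for closure
  under products.
\<close>

lemma character_is_weight_avoiding_variable:
  fixes G :: "('k::field ^ 'd::finite ^ 'd) set"
  assumes G: "subgroup G GL" "finite G"
    and diag: "\<And>A. A \<in> G \<Longrightarrow> diagonal A"
    and no_refl: "\<And>A. A \<in> G \<Longrightarrow> \<not> pseudo_reflection A"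
    and \<psi>: "\<psi> \<in> characters G"
  shows "\<exists>m. Poly_Mapping.lookup m j = 0 \<and> (\<forall>A\<in>G. weight A m = \<psi> A)"
proof -
  interpret S: group "GL\<lparr>carrier := G\<rparr>"
    by (rule group.subgroup_imp_group[OF group_GL G(1)])
  have one: "\<one>\<^bsub>GL\<lparr>carrier := G\<rparr>\<^esub> = mat 1"
    by (simp add: GL_def)
  define H :: "('k ^ 'd ^ 'd \<Rightarrow> 'k) set"
    where "H = {\<lambda>A. weight A m | m. Poly_Mapping.lookup m j = 0}"
  have "\<exists>h\<in>H. \<forall>A\<in>carrier (GL\<lparr>carrier := G\<rparr>). h A = \<psi> A"
  proof (rule S.separating_characters_exhaust)
    show "finite (carrier (GL\<lparr>carrier := G\<rparr>))" using G by simp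
    show "h (A \<otimes>\<^bsub>GL\<lparr>carrier := G\<rparr>\<^esub> B) = h A * h B"
      if "h \<in> H" "A \<in> carrier (GL\<lparr>carrier := G\<rparr>)" for h A B
      using that diag by (auto simp: H_def GL_def weight_mult)
    show "(\<lambda>_. 1) \<in> H"
      unfolding H_def by (auto intro!: exI[of _ 0])
    show "(\<lambda>A. h A * h' A) \<in> H" if "h \<in> H" "h' \<in> H" for h h'
    proof -
      obtain m m' where "h = (\<lambda>A. weight A m)" "Poly_Mapping.lookup m j = 0"
        "h' = (\<lambda>A. weight A m')" "Poly_Mapping.lookup m' j = 0"
        using \<open>h \<in> H\<close> \<open>h' \<in> H\<close> unfolding H_def by blast
      then show ?thesis
        unfolding H_def by (auto simp: weight_plus lookup_add intro!: exI[of _ "m + m'"])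
    qed
    show "\<exists>h\<in>H. h A \<noteq> h \<one>\<^bsub>GL\<lparr>carrier := G\<rparr>\<^esub>"
      if A: "A \<in> carrier (GL\<lparr>carrier := G\<rparr>)" "A \<noteq> \<one>\<^bsub>GL\<lparr>carrier := G\<rparr>\<^esub>" for A
    proof -
      have AG: "A \<in> G" and ne: "A \<noteq> mat 1" using A by (simp_all add: one)
      obtain i where i: "i \<noteq> j" "A $ i $ i \<noteq> 1"
        using diagonal_pseudo_reflectionI[OF G AG diag[OF AG] ne, of j] no_refl[OF AG] by blast
      have in_H: "(\<lambda>A. weight A (Poly_Mapping.single i 1)) \<in> H"
        using i unfolding H_def by (auto simp: lookup_single intro!: exI[of _ "Poly_Mapping.single i 1"])
      have ne_one: "weight A (Poly_Mapping.single i 1) \<noteq> weight (mat 1) (Poly_Mapping.single i 1)"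
        using i by (simp only: weight_single) (simp add: mat_def)
      show ?thesis
        unfolding one by (rule bexI[where P = "\<lambda>h. h A \<noteq> h (mat 1)", OF ne_one in_H])
    qed
  qed (use \<psi> in \<open>auto simp: characters_iff GL_def\<close>)
  then show ?thesis by (auto simp: H_def)
qed

lemma inv_character:
  fixes G :: "('k::field ^ 'd::finite ^ 'd) set"
  assumes G: "subgroup G GL" and \<psi>: "\<psi> \<in> characters G"
  shows "A \<in> G \<Longrightarrow> \<psi> A * inv_character \<psi> A = 1"
    and "inv_character \<psi> \<in> characters G"
proof -
  interpret GL: group "GL :: ('k ^ 'd ^ 'd) monoid" by (rule group_GL)
  have mult: "\<psi> (A \<otimes>\<^bsub>GL\<^esub> B) = \<psi> A * \<psi> B" if "A \<in> G" "B \<in> G" for A B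
    using \<psi> that by (simp add: characters_iff GL_def)
  have nz: "\<psi> A \<noteq> 0" if "A \<in> G" for A
    using \<psi> that by (simp add: characters_iff)
  have one: "\<one>\<^bsub>GL\<^esub> \<in> G" by (rule subgroup.one_closed[OF G])
  have "\<psi> \<one>\<^bsub>GL\<^esub> * \<psi> \<one>\<^bsub>GL\<^esub> = \<psi> \<one>\<^bsub>GL\<^esub> * 1"
    unfolding mult[OF one one, symmetric] by simp
  then have \<psi>_one: "\<psi> \<one>\<^bsub>GL\<^esub> = 1"
    using nz[OF one] mult_left_cancel by blast
  show inv: "\<psi> A * inv_character \<psi> A = 1" if "A \<in> G" for A
  proof -
    have "\<psi> A * inv_character \<psi> A = \<psi> (A \<otimes>\<^bsub>GL\<^esub> inv\<^bsub>GL\<^esub> A)"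
      unfolding inv_character_def by (rule mult[symmetric, OF that subgroup.m_inv_closed[OF G that]])
    also have "A \<otimes>\<^bsub>GL\<^esub> inv\<^bsub>GL\<^esub> A = \<one>\<^bsub>GL\<^esub>"
      by (rule GL.r_inv[OF subgroup.mem_carrier[OF G that]])
    finally show ?thesis using \<psi>_one by simp
  qed
  have "inv_character \<psi> A = inverse (\<psi> A)" if "A \<in> G" for A
    by (rule inverse_unique[OF inv[OF that], symmetric])
  moreover have "A ** B \<in> G" if "A \<in> G" "B \<in> G" for A B
    using subgroup.m_closed[OF G that] by (simp add: GL_def)
  ultimately show "inv_character \<psi> \<in> characters G"
    using \<psi> by (simp add: characters_iff)
qed

theorem theorem1p2:
  fixes G :: "('k::alg_closed_field ^ 'd::finite ^ 'd) set"
    and \<sigma> :: "nat \<Rightarrow> 'k ^ 'd ^ 'd"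
    and \<xi> :: "nat \<Rightarrow> 'k"
    and n :: "nat \<Rightarrow> nat"
    and t :: "nat \<Rightarrow> 'd \<Rightarrow> nat"
    and l :: nat
    and \<psi> :: "'k ^ 'd ^ 'd \<Rightarrow> 'k"
  assumes "CARD('d) \<ge> 2"
    and "subgroup G GL" and "finite G" and "comm_group (GL\<lparr>carrier := G\<rparr>)"
    and "G = generate GL (\<sigma> ` {1..l})"
    and "\<not> CHAR('k) dvd card G"
    and "\<And>i. i \<in> {1..l} \<Longrightarrow> primitive_root_of_unity (n i) (\<xi> i)"
    and "\<And>i. i \<in> {1..l} \<Longrightarrow> \<sigma> i = (\<chi> j k. if j = k then \<xi> i ^ t i j else 0)"
    and "\<And>i. i \<in> {1..l} \<Longrightarrow> Gcd (insert (n i) (range (t i))) = 1"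
    and "\<And>i j. i \<in> {1..l} \<Longrightarrow> j \<in> {1..l} \<Longrightarrow> i \<noteq> j \<Longrightarrow> coprime (n i) (n j)"
    and "\<And>A. A \<in> G \<Longrightarrow> \<not> pseudo_reflection A"
    and "\<psi> \<in> characters G"
  shows "semi_invariants G \<psi> \<noteq> {0} \<and>
    trace_ideal (invariant_ring G) (semi_invariant_module G \<psi>) =
      semi_invariant_product G \<psi> (inv_character \<psi>)"
proof -
  let ?\<phi> = "inv_character \<psi>"
  have "G \<subseteq> carrier GL" using assms(2) by (rule subgroup.subset)
  have diag: "diagonal A" if "A \<in> G" for A
  proof (rule generate_diagonal)
    show "generate GL (\<sigma> ` {1..l}) \<subseteq> carrier GL" "A \<in> generate GL (\<sigma> ` {1..l})"
      using \<open>G \<subseteq> carrier GL\<close> that unfolding assms(5) by auto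
    show "diagonal B" if "B \<in> \<sigma> ` {1..l}" for B
    proof -
      obtain i where "i \<in> {1..l}" "B = \<sigma> i" using \<open>B \<in> \<sigma> ` {1..l}\<close> by blast
      with assms(8)[of i] show ?thesis by (simp add: diagonal_def)
    qed
  qed
  have avoid: "\<exists>m. Poly_Mapping.lookup m j = 0 \<and> (\<forall>A\<in>G. weight A m = \<theta> A)"
    if "\<theta> \<in> characters G" for \<theta> j
    by (rule character_is_weight_avoiding_variable[OF assms(2,3) diag assms(11) that])
  note \<phi> = inv_character[OF assms(2,12)]
  \<comment> \<open>Here the avoided variable does not matter, so an arbitrary one is chosen.\<close>
  obtain m where m: "\<forall>A\<in>G. weight A m = \<psi> A"
    using avoid[OF assms(12), of undefined] by blast
  obtain m' where m': "\<forall>A\<in>G. weight A m' = ?\<phi> A"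
    using avoid[OF \<phi>(2), of undefined] by blast
  have "Poly_Mapping.single m 1 \<in> semi_invariants G \<psi>"
    by (rule monomial_semi_invariant[OF diag]) (use m in simp_all)
  moreover have "Poly_Mapping.single m (1::'k) \<noteq> 0"
    by (metis lookup_single_eq lookup_zero zero_neq_one)
  ultimately have "semi_invariants G \<psi> \<noteq> {0}" by auto
  moreover have "trace_ideal (invariant_ring G) (semi_invariant_module G \<psi>) =
      semi_invariant_product G \<psi> ?\<phi>"
  proof (rule trace_ideal_semi_invariants[OF diag \<phi>(1)])
    fix h assume h: "h \<in> hom_to_ring (invariant_ring G) (semi_invariant_module G \<psi>)"
    show "\<exists>g\<in>semi_invariants G ?\<phi>. \<forall>x\<in>semi_invariants G \<psi>. h x = x * g"
    proof (rule hom_to_ring_is_mult[OF diag \<phi>(1) avoid[OF assms(12)] m' h])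
      show "\<exists>g\<in>semi_invariants G ?\<phi>. \<forall>x\<in>semi_invariants G \<psi>. h x = x * g"
        if "g \<in> semi_invariants G ?\<phi>" "\<And>x. x \<in> semi_invariants G \<psi> \<Longrightarrow> h x = x * g" for g
        using that by (intro bexI[of _ g] ballI)
    qed
  qed
  ultimately show ?thesis by (rule conjI)
qed

end
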